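(* Let $f\in\mathcal{C}$, and let $\Gamma_1,\Gamma_2,\Gamma_3$ be the initial logarithmic coefficients of its inverse function $f^{-1}$. Then (i) $-\frac{\sqrt{10}}{10}\le |\Gamma_2|-|\Gamma_1|\le \frac{1}{6}$; (ii) $|\Gamma_3|-|\Gamma_2|\le \frac{2\sqrt{10}}{75}$. All of these inequalities (both the lower and the upper bound in (i), and the bound in (ii)) are sharp.
   Context: Let $\mathbb{D}=\{z\in\mathbb{C}:|z|<1\}$. $\mathcal{A}$ is the class of functions $f$ analytic in $\mathbb{D}$ of the form $f(z)=z+a_2z^2+a_3z^3+\cdots$, and $\mathcal{S}$ is the subclass of $\mathcal{A}$ of functions univalent (injective) in $\mathbb{D}$. The class of convex functions is $$\mathcal{C}=\left\{f\in\mathcal{A}:\ \operatorname{Re}\left[1+\frac{zf''(z)}{f'(z)}\right]>0,\ z\in\mathbb{D}\right\}$$ (the condition being understood to include $f'(z)\neq 0$ in $\mathbb{D}$); it is a subclass of $\mathcal{S}$. By Koebe's $1/4$ theorem, each $f\in\mathcal{S}$ has an inverse $f^{-1}$ defined at least on the disk $|w|<1/4$, with expansion $f^{-1}(w)=w+A_2w^2+A_3w^3+\cdots$. The logarithmic coefficients $\Gamma_n$ of $f^{-1}$ are defined by $\log\frac{f^{-1}(w)}{w}=2\sum_{n=1}^\infty\Gamma_n w^n$ for $w$ near $0$ (branch of the logarithm vanishing at $w=0$). An inequality is called sharp if equality holds for at least one function $f$ in the class considered. *)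

theory Defs
  imports "HOL-Complex_Analysis.Complex_Analysis"
begin

definition class_A :: "(complex \<Rightarrow> complex) set" where
  "class_A = {f. f holomorphic_on ball 0 1 \<and> f 0 = 0 \<and> deriv f 0 = 1}"

definition class_S :: "(complex \<Rightarrow> complex) set" where
  "class_S = {f \<in> class_A. inj_on f (ball 0 1)}"

definition class_C :: "(complex \<Rightarrow> complex) set" where
  "class_C = {f \<in> class_A. \<forall>z\<in>ball 0 1.
     deriv f z \<noteq> 0 \<and> Re (1 + z * deriv (deriv f) z / deriv f z) > 0}"

(* Only the values on f ` ball 0 1 matter; for f in class_S this image is a
   neighbourhood of 0. *)
definition disk_inverse :: "(complex \<Rightarrow> complex) \<Rightarrow> complex \<Rightarrow> complex" where
  "disk_inverse f = inv_into (ball 0 1) f"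

(* The singularity of the quotient at 0 is removable with limit 1, so near 0 the
   principal branch Ln is the branch of the logarithm that vanishes at w = 0. *)
definition log_inverse_quotient :: "(complex \<Rightarrow> complex) \<Rightarrow> complex \<Rightarrow> complex" where
  "log_inverse_quotient f w = (if w = 0 then 0 else Ln (disk_inverse f w / w))"

definition inv_log_coeff :: "(complex \<Rightarrow> complex) \<Rightarrow> nat \<Rightarrow> complex" where
  "inv_log_coeff f n = fps_nth (fps_expansion (log_inverse_quotient f) 0) n / 2"

(* The Taylor coefficients above are those of a genuine convergent expansion. *)
lemma log_inverse_quotient_has_fps_expansion:
  assumes "f \<in> class_S"
  shows "log_inverse_quotient f has_fps_expansion Abs_fps (\<lambda>n. 2 * inv_log_coeff f n)"
proof -
  have hol: "f holomorphic_on ball 0 1" and inj: "inj_on f (ball 0 1)"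
    and f0: "f 0 = 0" and d0: "deriv f 0 = 1"
    using assms by (auto simp: class_S_def class_A_def)
  obtain g where g: "g holomorphic_on (f ` ball 0 1)"
      "\<And>z. z \<in> ball 0 1 \<Longrightarrow> deriv f z * deriv g (f z) = 1"
      "\<And>z. z \<in> ball 0 1 \<Longrightarrow> g (f z) = z"
    using holomorphic_has_inverse[OF hol open_ball inj] by blast
  have op: "open (f ` ball 0 1)"
    by (rule open_mapping_thm3[OF hol open_ball inj])
  have in0: "0 \<in> f ` ball 0 1"
    using f0 by (metis centre_in_ball imageI zero_less_one)
  have g0: "g 0 = 0" and dg0: "deriv g 0 = 1"
    using g(2)[of 0] g(3)[of 0] f0 d0 by simp_all
  have inv: "disk_inverse f w = g w" if "w \<in> f ` ball 0 1" for w
    using that g(3) inj by (auto simp: disk_inverse_def inv_into_f_f simp del: mem_ball)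
  define q where "q = (\<lambda>w. if w = 0 then deriv g 0 else (g w - g 0) / (w - 0))"
  have qhol: "q holomorphic_on (f ` ball 0 1)"
    unfolding q_def by (rule pole_lemma_open[OF g(1) op])
  have "q 0 = 1"
    using dg0 by (simp add: q_def)
  define T where "T = f ` ball 0 1 \<inter> q -` (- \<real>\<^sub>\<le>\<^sub>0)"
  have opT: "open T"
    unfolding T_def
    by (intro continuous_open_preimage holomorphic_on_imp_continuous_on qhol op) auto
  have T0: "0 \<in> T"
    using in0 \<open>q 0 = 1\<close> by (auto simp: T_def)
  have "(\<lambda>w. Ln (q w)) holomorphic_on T"
    by (intro holomorphic_intros holomorphic_on_subset[OF qhol]) (auto simp: T_def)
  moreover have "log_inverse_quotient f w = Ln (q w)" if "w \<in> T" for w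
    using that dg0 g0 inv by (auto simp: log_inverse_quotient_def q_def T_def)
  ultimately have "log_inverse_quotient f holomorphic_on T"
    by (metis (no_types, lifting) holomorphic_cong)
  hence "log_inverse_quotient f analytic_on {0}"
    using opT T0 analytic_at by blast
  hence "log_inverse_quotient f has_fps_expansion fps_expansion (log_inverse_quotient f) 0"
    by (rule analytic_at_imp_has_fps_expansion_0)
  moreover have "fps_expansion (log_inverse_quotient f) 0 = Abs_fps (\<lambda>n. 2 * inv_log_coeff f n)"
    by (simp add: fps_eq_iff inv_log_coeff_def)
  ultimately show ?thesis by simp
qed

end

theory Submission
  imports Defs
begin

text \<open>
  Every convex \<open>f\<close> comes with a function \<open>h\<close> that is holomorphic on the unit disk, bounded by 1
  there, and satisfies \<open>1 + z f''/f' = (1 + z h) / (1 - z h)\<close>; conversely, every such \<open>h\<close> arises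
  from a convex \<open>f\<close>. Writing the equation as \<open>f'' (1 - z h) = 2 h f'\<close> and comparing power series,
  the first coefficients \<open>a, b, d\<close> of \<open>h\<close> determine those of \<open>f\<close>, and hence
  \<open>\<Gamma>\<^sub>1 = - a / 2\<close>, \<open>\<Gamma>\<^sub>2 = - (2 b - 3 a\<^sup>2) / 12\<close>, \<open>\<Gamma>\<^sub>3 = - (d - 3 a b + 2 a^3) / 12\<close>
  (lemma \<open>inv_log_coeff_schwarz_coeffs\<close>).

  The Schur algorithm bounds the coefficients of \<open>h\<close> by \<open>\<bar>b\<bar> \<le> 1 - \<bar>a\<bar>\<^sup>2\<close> and
  \<open>\<bar>d\<bar> \<le> 1 - \<bar>a\<bar>\<^sup>2 - \<bar>b\<bar>\<^sup>2 / (1 + \<bar>a\<bar>)\<close>. The first gives (i) through the triangle inequality.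
  For (ii) the point is the identity
  \<open>\<bar>3 b - 2 a\<^sup>2\<bar>\<^sup>2 - \<bar>2 b - 3 a\<^sup>2\<bar>\<^sup>2 = 5 (\<bar>b\<bar>\<^sup>2 - \<bar>a\<bar>^4)\<close>: for fixed \<open>\<bar>a\<bar>\<close> and \<open>\<bar>b\<bar>\<close> it makes the
  two moduli functions of each other. If \<open>\<bar>b\<bar> \<le> \<bar>a\<bar>\<^sup>2\<close>, the bound is then immediate; otherwise the
  worst argument of \<open>b\<close> is the one in which \<open>b\<close> is aligned with \<open>a\<^sup>2\<close>. What remains is a maximum over the two real
  variables \<open>\<bar>a\<bar>, \<bar>b\<bar>\<close>, attained at \<open>\<bar>a\<bar>\<^sup>2 = 2/5\<close>, \<open>\<bar>b\<bar> = 1 - \<bar>a\<bar>\<^sup>2\<close>.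

  The functions \<open>h z = (c + z) / (1 + c z)\<close> satisfy both coefficient bounds with equality. The
  choice \<open>c = 0\<close> gives equality in the upper bound of (i), and \<open>c = sqrt 10 / 5\<close>, for which
  \<open>\<Gamma>\<^sub>2 = 0\<close>, gives equality in the other two bounds.

  With \<open>g\<close> the inverse of \<open>f\<close>, the power series of \<open>log (g w / w)\<close> is available only for injective \<open>f\<close>, so it must be known
  that convex functions are injective. On the circle \<open>\<bar>z\<bar> = r\<close> the tangent direction of
  the image curve rotates monotonically and by \<open>2\<pi>\<close> in total. Of the two arcs between two distinct
  points, one therefore turns by at most \<open>\<pi>\<close>, and an arc that turns by at most \<open>\<pi>\<close> advances
  strictly in a fixed direction and cannot close up. So \<open>f\<close> is injective on every circle; a
  minimal coincidence \<open>f x = f y\<close> would have to lie on one circle, so \<open>f\<close> is injective.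
\<close>

section \<open>Convex functions are injective\<close>

lemma class_C_log_deriv:
  assumes "f \<in> class_C"
  obtains g where "g holomorphic_on ball 0 1"
    and "\<And>z. z \<in> ball 0 1 \<Longrightarrow> deriv f z = exp (g z)"
    and "\<And>z. z \<in> ball 0 1 \<Longrightarrow> Re (1 + z * deriv g z) > 0"
proof -
  have hol: "f holomorphic_on ball 0 1" and nz: "\<And>z. z \<in> ball 0 1 \<Longrightarrow> deriv f z \<noteq> 0"
    and re: "\<And>z. z \<in> ball 0 1 \<Longrightarrow> Re (1 + z * deriv (deriv f) z / deriv f z) > 0"
    using assms by (auto simp: class_C_def class_A_def)
  have hol': "deriv f holomorphic_on ball 0 1"
    by (intro holomorphic_deriv hol open_ball)
  obtain g where g: "g holomorphic_on ball 0 1"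
      "\<And>z. z \<in> ball 0 1 \<Longrightarrow> deriv f z = exp (g z)"
    using contractible_imp_holomorphic_log[OF hol' convex_imp_contractible[OF convex_ball]] nz
    by blast
  have "Re (1 + z * deriv g z) > 0" if z: "z \<in> ball 0 1" for z
  proof -
    have dg: "(g has_field_derivative deriv g z) (at z)"
      using g(1) z by (intro holomorphic_derivI[of _ "ball 0 1"]) auto
    have ev: "\<forall>\<^sub>F w in nhds z. deriv f w = exp (g w)"
      using g(2) z by (intro eventually_nhds_in_open[THEN eventually_mono, of "ball 0 1"]) auto
    have "((\<lambda>w. exp (g w)) has_field_derivative exp (g z) * deriv g z) (at z)"
      by (rule DERIV_chain2[OF DERIV_exp dg])
    hence "deriv (deriv f) z = exp (g z) * deriv g z"
      using DERIV_imp_deriv deriv_cong_ev[OF ev refl] by simp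
    thus ?thesis using re[OF z] g(2)[OF z] by simp
  qed
  with g show thesis by (rule that)
qed

lemma circle_vector_derivative:
  "((\<lambda>t. of_real r * cis t) has_vector_derivative \<i> * (of_real r * cis t)) (at t)"
proof -
  have "((\<lambda>w. of_real r * exp (\<i> * w)) has_field_derivative of_real r * (exp (\<i> * of_real t) * \<i>)) (at (of_real t))"
    by (auto intro!: derivative_eq_intros)
  from has_vector_derivative_real_field[OF this] show ?thesis
    by (simp add: cis_conv_exp mult_ac)
qed

text \<open>
  The tangent of the image of the circle at \<open>f (c t)\<close> has the argument \<open>A t + \<pi>/2\<close>. Convexity says
  that \<open>A\<close> increases. Moreover it grows by \<open>2\<pi>\<close> per revolution, so one of the two arcs
  between the given points turns by at most \<open>\<pi>\<close>. Along such an arc, starting at \<open>s\<close>, the component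
  of \<open>f\<close> in the direction \<open>cis (A s)\<close> decreases strictly.
\<close>

lemma class_C_neq_on_circle:
  assumes f: "f \<in> class_C" and x: "x \<in> ball 0 1" and xy: "cmod x = cmod y" "x \<noteq> y"
  shows "f x \<noteq> f y"
proof -
  define r where "r = cmod x"
  have r: "0 < r" "r < 1" using x xy by (auto simp: r_def)
  obtain g where g: "g holomorphic_on ball 0 1"
      "\<And>z. z \<in> ball 0 1 \<Longrightarrow> deriv f z = exp (g z)"
      "\<And>z. z \<in> ball 0 1 \<Longrightarrow> Re (1 + z * deriv g z) > 0"
    using class_C_log_deriv[OF f] by blast
  have hol: "f holomorphic_on ball 0 1" using f by (auto simp: class_C_def class_A_def)
  define c where "c t = of_real r * cis t" for t
  have c_in: "c t \<in> ball 0 1" for t using r by (simp add: c_def norm_mult)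
  have dc: "(c has_vector_derivative \<i> * c t) (at t)" for t
    unfolding c_def by (rule circle_vector_derivative)
  define A where "A t = t + Im (g (c t))" for t
  have dA: "(A has_real_derivative Re (1 + c t * deriv g (c t))) (at t)" for t
  proof -
    have "((\<lambda>t. g (c t)) has_vector_derivative \<i> * c t * deriv g (c t)) (at t)"
      using field_vector_diff_chain_at[OF dc holomorphic_derivI[OF g(1) open_ball c_in]]
      by (simp add: o_def)
    from bounded_linear.has_vector_derivative[OF bounded_linear_Im this]
    have "((\<lambda>t. Im (g (c t))) has_real_derivative Im (\<i> * c t * deriv g (c t))) (at t)"
      by (simp add: has_real_derivative_iff_has_vector_derivative)
    from DERIV_add[OF DERIV_ident this] show ?thesis
      by (simp add: A_def [abs_def])
  qed
  have A_mono: "A s < A t" if "s < t" for s t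
    by (rule DERIV_pos_imp_increasing[OF that]) (blast intro: dA g(3)[OF c_in])
  have c_period: "c (t + 2 * pi) = c t" for t
    by (simp add: c_def complex_eq_iff)
  have A_period: "A (t + 2 * pi) = A t + 2 * pi" for t
    by (simp add: A_def c_period)
  have short: "f (c s) \<noteq> f (c t)" if "s < t" "A t - A s \<le> pi" for s t
  proof -
    define B where "B u = Re (cis (- A s) * f (c u))" for u
    have dB: "(B has_real_derivative - (r * exp (Re (g (c u))) * sin (A u - A s))) (at u)" for u
    proof -
      have "((\<lambda>u. f (c u)) has_vector_derivative \<i> * c u * deriv f (c u)) (at u)"
        using field_vector_diff_chain_at[OF dc holomorphic_derivI[OF hol open_ball c_in]]
        by (simp add: o_def)
      hence "((\<lambda>u. cis (- A s) * f (c u)) has_vector_derivative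
               cis (- A s) * (\<i> * c u * deriv f (c u))) (at u)"
        by (rule has_vector_derivative_mult_right)
      from bounded_linear.has_vector_derivative[OF bounded_linear_Re this]
      have "(B has_real_derivative Re (cis (- A s) * (\<i> * c u * deriv f (c u)))) (at u)"
        by (simp add: has_real_derivative_iff_has_vector_derivative B_def [abs_def])
      also have "cis (- A s) * (\<i> * c u * deriv f (c u)) =
          of_real (r * exp (Re (g (c u)))) * (\<i> * cis (A u - A s))"
      proof -
        have "deriv f (c u) = of_real (exp (Re (g (c u)))) * cis (Im (g (c u)))"
          using g(2)[OF c_in[of u]] by (simp add: exp_eq_polar)
        moreover have "cis (A u - A s) = cis (- A s) * (cis u * cis (Im (g (c u))))"
          by (simp add: cis_mult A_def algebra_simps)
        ultimately show ?thesis by (simp add: c_def mult_ac)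
      qed
      also have "Re \<dots> = - (r * exp (Re (g (c u))) * sin (A u - A s))" by simp
      finally show ?thesis .
    qed
    have "B t < B s"
    proof (rule DERIV_neg_imp_decreasing_open[OF that(1)])
      fix u assume u: "s < u" "u < t"
      have "0 < sin (A u - A s)"
        using A_mono[OF u(1)] A_mono[OF u(2)] that(2) by (intro sin_gt_zero) auto
      thus "\<exists>y. (B has_real_derivative y) (at u) \<and> y < 0" using dB[of u] r by fastforce
    qed (rule continuous_at_imp_continuous_on, blast intro: DERIV_isCont[OF dB])
    thus ?thesis by (auto simp: B_def)
  qed
  have main: "f (c s) \<noteq> f (c t)" if "s < t" "t < s + 2 * pi" for s t
  proof (cases "A t - A s \<le> pi")
    case False
    have "f (c t) \<noteq> f (c (s + 2 * pi))"
      using that False by (intro short) (auto simp: A_period)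
    thus ?thesis unfolding c_period by (rule not_sym)
  qed (rule short[OF that(1)])
  have xc: "x = c (Arg x)" 
    using rcis_cmod_Arg[of x] by (simp add: c_def r_def rcis_def)
  have yc: "y = c (Arg y)"
    using rcis_cmod_Arg[of y] by (simp add: c_def r_def rcis_def xy)
  have "Arg x \<noteq> Arg y" using xc yc xy by metis
  moreover have "-pi < Arg x" "Arg x \<le> pi" "-pi < Arg y" "Arg y \<le> pi"
    using Arg_bounded by auto
  ultimately consider "Arg x < Arg y" "Arg y < Arg x + 2 * pi" | "Arg y < Arg x" "Arg x < Arg y + 2 * pi"
    by linarith
  thus ?thesis
  proof cases
    case 1
    from main[OF this] show ?thesis unfolding xc[symmetric] yc[symmetric] .
  next
    case 2
    from main[OF this] have "f y \<noteq> f x" unfolding xc[symmetric] yc[symmetric] .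
    thus ?thesis by (rule not_sym)
  qed
qed

text \<open>
  Among all pairs \<open>x \<noteq> y\<close> with \<open>f x = f y\<close> a compactness argument finds one for which the larger
  modulus is minimal; local injectivity keeps the pairs away from the diagonal. The two moduli cannot
  agree, and if \<open>\<bar>x\<bar> < \<bar>y\<bar>\<close>, then \<open>y\<close> can be moved inwards: as \<open>f\<close> is open near \<open>x\<close>, some \<open>x'\<close> follows, which
  contradicts minimality.
\<close>

lemma inj_on_disk_if_inj_on_circles:
  assumes hol: "f holomorphic_on ball 0 1"
    and nz: "\<And>z. z \<in> ball 0 1 \<Longrightarrow> deriv f z \<noteq> 0"
    and circ: "\<And>x y. x \<in> ball 0 1 \<Longrightarrow> cmod x = cmod y \<Longrightarrow> x \<noteq> y \<Longrightarrow> f x \<noteq> f y"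
  shows "inj_on f (ball 0 1)"
proof (rule ccontr)
  assume "\<not> inj_on f (ball 0 1)"
  then obtain a b where ab: "a \<in> ball 0 1" "b \<in> ball 0 1" "a \<noteq> b" "f a = f b"
    by (auto simp: inj_on_def)
  define R where "R = max (cmod a) (cmod b)"
  have R: "R < 1" using ab by (auto simp: R_def)
  have sub: "cball 0 R \<subseteq> ball (0::complex) 1"
    unfolding cball_subset_ball_iff using R by simp
  define U where "U = (\<Union>V\<in>{V. open V \<and> inj_on f V}. V \<times> V)"
  define E where "E = {p \<in> cball 0 R \<times> cball 0 R. f (fst p) - f (snd p) = 0}"
  have cf: "continuous_on (cball 0 R) f"
    by (rule continuous_on_subset[OF holomorphic_on_imp_continuous_on[OF hol] sub])
  have "continuous_on (cball 0 R \<times> cball 0 R) (\<lambda>p. f (fst p) - f (snd p))"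
    by (rule continuous_on_diff; rule continuous_on_compose2[OF cf])
       (auto intro: continuous_on_fst continuous_on_snd)
  hence "closed E"
    unfolding E_def by (intro continuous_closed_preimage_constant closed_Times) auto
  moreover have "bounded E"
    unfolding E_def by (rule bounded_subset[OF bounded_Times[OF bounded_cball bounded_cball]]) auto
  ultimately have "compact E" by (simp add: compact_eq_bounded_closed)
  moreover have "open U" unfolding U_def by (intro open_UN ballI open_Times) auto
  moreover define K where "K = E - U"
  ultimately have "compact K" by (auto intro: compact_diff)
  \<comment> \<open>Removing the open set \<open>U\<close> cuts a neighbourhood of the diagonal out of \<open>E\<close> without losing
    any pair of distinct points with equal values.\<close>
  have diag: "(x, x) \<in> U" if "x \<in> cball 0 R" for x
  proof -
    have x: "x \<in> ball 0 1" using that sub by (rule subsetD[rotated])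
    obtain d where "d > 0" "inj_on f (ball x d)"
      using has_complex_derivative_locally_injective[OF hol x open_ball nz[OF x]] by blast
    thus ?thesis unfolding U_def by (intro UN_I[of "ball x d"]) auto
  qed
  have offdiag: "x = y" if "(x, y) \<in> U" "f x = f y" for x y
    using that by (auto simp: U_def inj_on_def)
  have EU: "(x, y) \<in> K \<longleftrightarrow> x \<in> cball 0 R \<and> y \<in> cball 0 R \<and> x \<noteq> y \<and> f x = f y" for x y
    using diag[of x] offdiag[of x y] by (auto simp: E_def K_def)
  have "(a, b) \<in> K" using ab by (auto simp: EU R_def)
  hence "K \<noteq> {}" by blast
  have "continuous_on K (\<lambda>p. max (cmod (fst p)) (cmod (snd p)))"
    by (intro continuous_intros)
  from continuous_attains_inf[OF \<open>compact K\<close> \<open>K \<noteq> {}\<close> this]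
  obtain p where p: "p \<in> K" and pmin: "\<And>q. q \<in> K \<Longrightarrow>
      max (cmod (fst p)) (cmod (snd p)) \<le> max (cmod (fst q)) (cmod (snd q))" by blast
  have contra: False if xy: "(x, y) \<in> K" "cmod x < cmod y"
    and min: "\<And>x' y'. (x', y') \<in> K \<Longrightarrow> cmod y \<le> max (cmod x') (cmod y')" for x y
  proof -
    define m where "m = (cmod x + cmod y) / 2"
    have m: "cmod x < m" "m < cmod y" using xy by (auto simp: m_def)
    have x: "x \<in> ball 0 1" and y: "y \<in> ball 0 1" "cmod y \<le> R"
      using xy sub by (auto simp: EU)
    obtain d where d: "d > 0" "inj_on f (ball x d)" "ball x d \<subseteq> ball 0 1"
      using has_complex_derivative_locally_injective[OF hol x open_ball nz[OF x]] by blast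
    define V where "V = ball x d \<inter> ball 0 m"
    have "open V" "x \<in> V" using d m by (auto simp: V_def)
    have "open (f ` V)"
      using d hol by (intro open_mapping_thm3)
        (auto simp: V_def intro: holomorphic_on_subset inj_on_subset)
    moreover have "f y \<in> f ` V" using imageI[OF \<open>x \<in> V\<close>, of f] xy by (simp add: EU)
    moreover have "isCont (\<lambda>t. f (of_real t * y)) 1"
    proof -
      have "isCont f y"
        using holomorphic_on_imp_continuous_on[OF hol] y(1)
        by (simp add: continuous_on_eq_continuous_at del: mem_ball)
      thus ?thesis
        by (intro isCont_o2[where g=f and f="\<lambda>t. of_real t * y"] continuous_intros) auto
    qed
    ultimately have "\<forall>\<^sub>F t in at (1::real). f (of_real t * y) \<in> f ` V"
      by (intro topological_tendstoD) (auto simp: isCont_def)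
    hence e1: "\<forall>\<^sub>F t in at_left (1::real). f (of_real t * y) \<in> f ` V"
      by (simp add: eventually_at_split)
    have "((\<lambda>t. t * cmod y) \<longlongrightarrow> 1 * cmod y) (at_left (1::real))"
      by (intro tendsto_intros)
    hence e2: "\<forall>\<^sub>F t in at_left (1::real). m < t * cmod y"
      using m by (intro order_tendstoD) auto
    have e3: "\<forall>\<^sub>F t in at_left (1::real). t \<in> {0<..<1}"
      by (rule eventually_at_left_real) auto
    obtain t where t: "f (of_real t * y) \<in> f ` V" "m < t * cmod y" "0 < t" "t < 1"
      using eventually_happens'[OF _ eventually_conj[OF e1 eventually_conj[OF e2 e3]]] by auto
    then obtain x' where x': "x' \<in> V" "f x' = f (of_real t * y)" by auto
    have "0 < cmod y" using m norm_ge_zero[of x] by linarith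
    hence lt: "t * cmod y < cmod y" using t by simp
    have "cmod x' < m" using x' by (auto simp: V_def)
    hence "(x', of_real t * y) \<in> K"
      using x' t m y lt by (auto simp: EU norm_mult)
    from min[OF this] show False using lt \<open>cmod x' < m\<close> m t by (auto simp: norm_mult)
  qed
  obtain x y where pxy: "p = (x, y)" by fastforce
  have sym: "(y, x) \<in> K" using p pxy by (auto simp: EU)
  have xin: "x \<in> ball 0 1" "x \<noteq> y" "f x = f y" using p pxy sub by (auto simp: EU)
  consider "cmod x = cmod y" | "cmod x < cmod y" | "cmod y < cmod x" by linarith
  thus False
  proof cases
    case 1 thus ?thesis using circ xin by blast
  next
    case 2 thus ?thesis using contra[of x y] p pmin pxy by fastforce
  next
    case 3 thus ?thesis using contra[OF sym] pmin pxy by fastforce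
  qed
qed

lemma class_C_subset_class_S: "class_C \<subseteq> class_S"
proof
  fix f assume f: "f \<in> class_C"
  hence A: "f \<in> class_A" and nz: "\<And>z. z \<in> ball 0 1 \<Longrightarrow> deriv f z \<noteq> 0"
    by (simp_all add: class_C_def)
  have "f holomorphic_on ball 0 1" using A by (simp add: class_A_def)
  hence "inj_on f (ball 0 1)"
    by (rule inj_on_disk_if_inj_on_circles[OF _ nz class_C_neq_on_circle[OF f]])
  thus "f \<in> class_S" using A by (simp add: class_S_def)
qed

section \<open>Coefficients of functions bounded by one\<close>
text \<open>
  The Schwarz lemma in the form needed to peel off one coefficient: dividing by \<open>z\<close> preserves the
  bound, also at the removable singularity.
\<close>

lemma schwarz_quotient:
  assumes h: "h holomorphic_on ball 0 1" "h 0 = 0" and b: "\<And>z. cmod z < 1 \<Longrightarrow> cmod (h z) < 1"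
  obtains k where "k holomorphic_on ball 0 1" and "\<And>z. cmod z < 1 \<Longrightarrow> h z = z * k z"
    and "\<And>z. cmod z < 1 \<Longrightarrow> cmod (k z) \<le> 1"
proof -
  obtain k where k: "k holomorphic_on ball 0 1" "\<And>z. cmod z < 1 \<Longrightarrow> h z = z * k z" "deriv h 0 = k 0"
    using Schwarz3[OF h] by metis
  have "cmod (k z) \<le> 1" if z: "cmod z < 1" for z
  proof (cases "z = 0")
    case True
    thus ?thesis using Schwarz_Lemma(2)[OF h b z] k(3) by simp
  next
    case False
    have "cmod z * cmod (k z) \<le> cmod z * 1"
      using Schwarz_Lemma(1)[OF h b z] k(2)[OF z] by (simp add: norm_mult)
    thus ?thesis using False by simp
  qed
  with k show thesis using that by blast
qed

lemma bounded_by_one_cases: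
  assumes h: "h holomorphic_on ball 0 1" and b: "\<And>z. cmod z < 1 \<Longrightarrow> cmod (h z) \<le> 1"
  shows "(\<exists>c. cmod c = 1 \<and> (\<forall>z. cmod z < 1 \<longrightarrow> h z = c)) \<or> (\<forall>z. cmod z < 1 \<longrightarrow> cmod (h z) < 1)"
proof (cases "\<exists>w. cmod w < 1 \<and> cmod (h w) = 1")
  case True
  then obtain w where w: "cmod w < 1" "cmod (h w) = 1" by blast
  have "h constant_on ball 0 1"
    by (rule maximum_modulus_principle[OF h, of "ball 0 1" w]) (use b w in auto)
  then obtain c where "\<And>z. z \<in> ball 0 1 \<Longrightarrow> h z = c" by (auto simp: constant_on_def)
  thus ?thesis using w by auto
next
  case False
  thus ?thesis using b by (metis order_less_le)
qed

text \<open>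
  One step of the Schur algorithm: a disk automorphism moves \<open>h 0\<close> to the origin, where the Schwarz
  lemma applies. The equation is stated without quotients, so that it can be compared
  coefficient by coefficient.
\<close>

lemma schur_step:
  assumes h: "h holomorphic_on ball 0 1" and b: "\<And>z. cmod z < 1 \<Longrightarrow> cmod (h z) < 1"
  obtains k where "k holomorphic_on ball 0 1" and "\<And>z. cmod z < 1 \<Longrightarrow> cmod (k z) \<le> 1"
    and "\<And>z. cmod z < 1 \<Longrightarrow> h z - h 0 = z * k z * (1 - cnj (h 0) * h z)"
proof -
  define a where "a = h 0"
  have a: "cmod a < 1" using b[of 0] by (simp add: a_def)
  define m where "m z = (h z - a) / (1 - cnj a * h z)" for z
  have nz: "1 - cnj a * h z \<noteq> 0" if "cmod z < 1" for z
  proof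
    assume "1 - cnj a * h z = 0"
    hence "cmod (cnj a * h z) = 1" by (metis eq_iff_diff_eq_0 norm_one)
    moreover have "cmod a * cmod (h z) < 1 * 1"
      using a b[OF that] by (intro mult_strict_mono') auto
    ultimately show False by (simp add: norm_mult)
  qed
  have "cmod (m z) < 1" if z: "cmod z < 1" for z
    using Moebius_function_norm_lt_1[OF a b[OF z], of 0]
    by (simp add: m_def Moebius_function_def)
  moreover have "m holomorphic_on ball 0 1"
    unfolding m_def using nz h by (intro holomorphic_intros) auto
  ultimately obtain k where k: "k holomorphic_on ball 0 1" "\<And>z. cmod z < 1 \<Longrightarrow> m z = z * k z"
      "\<And>z. cmod z < 1 \<Longrightarrow> cmod (k z) \<le> 1"
    using schwarz_quotient[of m] by (auto simp: m_def a_def)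
  show thesis
  proof (rule that[OF k(1) k(3)])
    fix z :: complex assume z: "cmod z < 1"
    show "h z - h 0 = z * k z * (1 - cnj (h 0) * h z)"
      using k(2)[OF z] nz[OF z] by (simp add: m_def a_def divide_simps)
  qed
qed

lemma holomorphic_disk_fps:
  "h holomorphic_on ball 0 1 \<Longrightarrow> h has_fps_expansion fps_expansion h 0"
  by (rule has_fps_expansion_fps_expansion[of "ball 0 1"]) auto

lemma eventually_disk: "(\<And>z. cmod z < 1 \<Longrightarrow> P z) \<Longrightarrow> eventually P (nhds (0::complex))"
  using eventually_nhds_in_open[of "ball (0::complex) 1" 0] by (auto elim!: eventually_mono)

lemma fps_eq_of_eq_on_disk:
  fixes f g :: "complex \<Rightarrow> complex"
  assumes F: "f has_fps_expansion F" and G: "g has_fps_expansion G"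
    and eq: "\<And>z. cmod z < 1 \<Longrightarrow> f z = g z"
  shows "F = G"
proof -
  have "f has_fps_expansion G"
    using has_fps_expansion_cong[OF eventually_disk[of "\<lambda>z. f z = g z", OF eq] refl] G by blast
  thus ?thesis using F by (rule fps_expansion_unique_complex[OF _ _, symmetric])
qed

lemma schur_step_fps:
  assumes h: "h holomorphic_on ball 0 1" and b: "\<And>z. cmod z < 1 \<Longrightarrow> cmod (h z) < 1"
    and H: "h has_fps_expansion H"
  obtains k K where "k holomorphic_on ball 0 1" "\<And>z. cmod z < 1 \<Longrightarrow> cmod (k z) \<le> 1"
    "k has_fps_expansion K" 
    "H - fps_const (fps_nth H 0) = fps_X * K * (1 - fps_const (cnj (fps_nth H 0)) * H)"
proof -
  obtain k where k: "k holomorphic_on ball 0 1" "\<And>z. cmod z < 1 \<Longrightarrow> cmod (k z) \<le> 1"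
    and eq: "\<And>z. cmod z < 1 \<Longrightarrow> h z - h 0 = z * k z * (1 - cnj (h 0) * h z)"
    using schur_step[OF h b] by blast
  define K where "K = fps_expansion k 0"
  have K: "k has_fps_expansion K" unfolding K_def by (rule holomorphic_disk_fps[OF k(1)])
  have h0: "h 0 = fps_nth H 0" by (rule has_fps_expansion_imp_0_eq_fps_nth_0[OF H])
  have "(\<lambda>z. h z - h 0) has_fps_expansion H - fps_const (fps_nth H 0)"
    unfolding h0 by (intro fps_expansion_intros H)
  moreover have "(\<lambda>z. z * k z * (1 - cnj (h 0) * h z)) has_fps_expansion
      fps_X * K * (1 - fps_const (cnj (fps_nth H 0)) * H)"
    unfolding h0 by (intro fps_expansion_intros H K)
  ultimately have "H - fps_const (fps_nth H 0) = fps_X * K * (1 - fps_const (cnj (fps_nth H 0)) * H)"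
    by (rule fps_eq_of_eq_on_disk[OF _ _ eq])
  with k K show thesis using that by blast
qed

lemma fps_mult_nth_1: "fps_nth (f * g) 1 = fps_nth f 0 * fps_nth g 1 + fps_nth f 1 * fps_nth g 0"
  for f g :: "'a::comm_semiring_1 fps"
  by (simp add: fps_mult_nth)

text \<open>
  By the Schur step the coefficient at \<open>z\<close> is \<open>k 0 (1 - \<bar>h 0\<bar>\<^sup>2)\<close>. This is the Schwarz-Pick inequality at
  the origin.
\<close>

lemma schwarz_coeff_1_bound:
  assumes h: "h holomorphic_on ball 0 1" and b: "\<And>z. cmod z < 1 \<Longrightarrow> cmod (h z) \<le> 1"
    and H: "h has_fps_expansion H"
  shows "cmod (fps_nth H 1) \<le> 1 - (cmod (fps_nth H 0))\<^sup>2"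
proof -
  consider (const) c where "cmod c = 1" "\<And>z. cmod z < 1 \<Longrightarrow> h z = c"
    | (strict) "\<And>z. cmod z < 1 \<Longrightarrow> cmod (h z) < 1"
    using bounded_by_one_cases[OF h b] by blast
  thus ?thesis
  proof cases
    case (const c)
    have "H = fps_const c"
      by (rule fps_eq_of_eq_on_disk[OF H has_fps_expansion_const const(2)])
    thus ?thesis using const by simp
  next
    case strict
    obtain k K where k: "k holomorphic_on ball 0 1" "\<And>z. cmod z < 1 \<Longrightarrow> cmod (k z) \<le> 1"
      "k has_fps_expansion K" and
      eq: "H - fps_const (fps_nth H 0) = fps_X * K * (1 - fps_const (cnj (fps_nth H 0)) * H)"
      using schur_step_fps[OF h strict H] by metis
    have "fps_nth H 1 = fps_nth K 0 * (1 - cnj (fps_nth H 0) * fps_nth H 0)"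
      using arg_cong[OF eq, of "\<lambda>F. fps_nth F 1"] by (simp add: mult.assoc)
    also have "cnj (fps_nth H 0) * fps_nth H 0 = of_real ((cmod (fps_nth H 0))\<^sup>2)"
      by (metis complex_norm_square mult.commute)
    finally have "cmod (fps_nth H 1) = cmod (fps_nth K 0) * \<bar>1 - (cmod (fps_nth H 0))\<^sup>2\<bar>"
      by (metis norm_mult norm_of_real of_real_1 of_real_diff)
    moreover have "cmod (fps_nth K 0) \<le> 1"
      using k(2)[of 0] has_fps_expansion_imp_0_eq_fps_nth_0[OF k(3)] by simp
    moreover have "cmod (fps_nth H 0) < 1" 
      using strict[of 0] has_fps_expansion_imp_0_eq_fps_nth_0[OF H] by simp
    hence "(cmod (fps_nth H 0))\<^sup>2 \<le> 1" by (simp add: power_le_one)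
    ultimately show ?thesis by (simp add: mult_left_le_one_le)
  qed
qed

text \<open>
  With \<open>s, t\<close> the first two coefficients of the Schur transform of \<open>h\<close>, the next coefficients of \<open>h\<close>
  after \<open>a = h 0\<close> are \<open>(1 - \<bar>a\<bar>\<^sup>2) s\<close> and \<open>(1 - \<bar>a\<bar>\<^sup>2) (t - cnj a s\<^sup>2)\<close>; the previous bound, applied to the transform, gives
  \<open>\<bar>t\<bar> \<le> 1 - \<bar>s\<bar>\<^sup>2\<close>.
\<close>

lemma schwarz_coeff_2_bound:
  assumes h: "h holomorphic_on ball 0 1" and b: "\<And>z. cmod z < 1 \<Longrightarrow> cmod (h z) \<le> 1"
    and H: "h has_fps_expansion H"
  shows "cmod (fps_nth H 2) \<le> 1 - (cmod (fps_nth H 0))\<^sup>2 - (cmod (fps_nth H 1))\<^sup>2 / (1 + cmod (fps_nth H 0))"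
proof -
  consider (const) c where "cmod c = 1" "\<And>z. cmod z < 1 \<Longrightarrow> h z = c"
    | (strict) "\<And>z. cmod z < 1 \<Longrightarrow> cmod (h z) < 1"
    using bounded_by_one_cases[OF h b] by blast
  thus ?thesis
  proof cases
    case (const c)
    have "H = fps_const c"
      by (rule fps_eq_of_eq_on_disk[OF H has_fps_expansion_const const(2)])
    thus ?thesis using const by simp
  next
    case strict
    obtain k K where k: "k holomorphic_on ball 0 1" "\<And>z. cmod z < 1 \<Longrightarrow> cmod (k z) \<le> 1"
      "k has_fps_expansion K" and
      eq: "H - fps_const (fps_nth H 0) = fps_X * K * (1 - fps_const (cnj (fps_nth H 0)) * H)"
      using schur_step_fps[OF h strict H] by metis
    define a c s t where "a = fps_nth H 0" and "c = cmod a" and "s = fps_nth K 0" and "t = fps_nth K 1"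
    have c: "0 \<le> c" "c < 1"
      using strict[of 0] has_fps_expansion_imp_0_eq_fps_nth_0[OF H] by (auto simp: a_def c_def)
    hence D: "0 < 1 - c\<^sup>2" by (simp add: power_less_one_iff abs_square_less_1)
    have aa: "cnj a * a = of_real (c\<^sup>2)"
      by (metis complex_norm_square mult.commute c_def)
    have H1: "fps_nth H 1 = of_real (1 - c\<^sup>2) * s"
      using arg_cong[OF eq, of "\<lambda>F. fps_nth F 1"] aa by (simp add: mult.assoc a_def s_def mult.commute)
    have "fps_nth H 2 = t * (1 - cnj a * a) - s * cnj a * fps_nth H 1"
      using arg_cong[OF eq, of "\<lambda>F. fps_nth F 2"]
      by (simp add: mult.assoc a_def s_def t_def fps_mult_nth_1 numeral_2_eq_2 del: One_nat_def)
         (simp add: algebra_simps)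
    hence H2: "fps_nth H 2 = of_real (1 - c\<^sup>2) * (t - cnj a * s\<^sup>2)"
      unfolding aa H1 by (simp add: algebra_simps power2_eq_square)
    have t: "cmod t \<le> 1 - (cmod s)\<^sup>2"
      unfolding s_def t_def by (rule schwarz_coeff_1_bound[OF k])
    have "cmod (t - cnj a * s\<^sup>2) \<le> cmod t + cmod (cnj a * s\<^sup>2)" by (rule norm_triangle_ineq4)
    also have "\<dots> \<le> 1 - (cmod s)\<^sup>2 + c * (cmod s)\<^sup>2"
      using t by (simp add: norm_mult norm_power c_def)
    finally have "cmod (fps_nth H 2) \<le> (1 - c\<^sup>2) * (1 - (cmod s)\<^sup>2 + c * (cmod s)\<^sup>2)"
      using D unfolding H2 norm_mult norm_of_real by simp
    also have "\<dots> = 1 - c\<^sup>2 - ((1 - c\<^sup>2) * cmod s)\<^sup>2 / (1 + c)"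
      using c by (simp add: divide_simps) algebra
    also have "(1 - c\<^sup>2) * cmod s = cmod (fps_nth H 1)"
      using D unfolding H1 norm_mult norm_of_real by simp
    finally show ?thesis by (simp add: c_def a_def)
  qed
qed

section \<open>From convex functions to bounded functions and logarithmic coefficients\<close>
text \<open>
  The Cayley transform takes \<open>1 + z f''/f'\<close>, which maps into the right half-plane, to a function \<open>w\<close> with
  values in the unit disk and \<open>w 0 = 0\<close>; then \<open>h = w / z\<close>.
\<close>

lemma convex_schwarz_function:
  assumes f: "f \<in> class_C"
  obtains h where "h holomorphic_on ball 0 1" "\<And>z. cmod z < 1 \<Longrightarrow> cmod (h z) \<le> 1"
    "\<And>z. cmod z < 1 \<Longrightarrow> deriv (deriv f) z * (1 - z * h z) = 2 * h z * deriv f z"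
proof -
  have hol: "f holomorphic_on ball 0 1" and nz: "\<And>z. cmod z < 1 \<Longrightarrow> deriv f z \<noteq> 0"
    and re: "\<And>z. cmod z < 1 \<Longrightarrow> Re (1 + z * deriv (deriv f) z / deriv f z) > 0"
    using f by (auto simp: class_C_def class_A_def)
  define q where "q z = deriv (deriv f) z / deriv f z" for z
  define w where "w z = z * q z / (2 + z * q z)" for z
  have re': "Re (z * q z) > -1" if "cmod z < 1" for z
    using re[OF that] by (simp add: q_def)
  have n2: "2 + z * q z \<noteq> 0" if "cmod z < 1" for z
    using re'[OF that] by (auto simp: complex_eq_iff)
  have "q holomorphic_on ball 0 1"
    unfolding q_def using hol nz by (intro holomorphic_intros) auto
  hence "w holomorphic_on ball 0 1"
    unfolding w_def using n2 by (intro holomorphic_intros) auto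
  moreover have "cmod (w z) < 1" if z: "cmod z < 1" for z
  proof -
    define p where "p = z * q z"
    have "(cmod p)\<^sup>2 < (cmod (2 + p))\<^sup>2"
      unfolding cmod_power2 using re'[OF z] by (simp add: p_def[symmetric] power2_eq_square algebra_simps)
    hence "cmod p < cmod (2 + p)" by (rule power_less_imp_less_base) simp
    thus ?thesis using n2[OF z] by (simp add: w_def norm_divide flip: p_def)
  qed
  ultimately obtain h where h: "h holomorphic_on ball 0 1" "\<And>z. cmod z < 1 \<Longrightarrow> w z = z * h z"
    "\<And>z. cmod z < 1 \<Longrightarrow> cmod (h z) \<le> 1"
    using schwarz_quotient[of w] by (auto simp: w_def)
  define d where "d z = deriv (deriv f) z * (1 - z * h z) - 2 * h z * deriv f z" for z
  have "d z = 0" if z: "cmod z < 1" for z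
  proof -
    \<comment> \<open>The factor \<open>x\<close> is cancelled outside the origin; continuity covers the origin.\<close>
    have zd: "x * d x = 0" if x: "cmod x < 1" for x
    proof -
      have "x * q x * (1 - w x) = 2 * w x"
        using n2[OF x] by (simp add: w_def divide_simps)
      hence "x * q x * (1 - x * h x) = 2 * (x * h x)" by (simp add: h(2)[OF x])
      thus ?thesis using nz[OF x] by (simp add: q_def d_def field_simps)
    qed
    have "d holomorphic_on ball 0 1"
      unfolding d_def using hol h(1) by (intro holomorphic_intros) auto
    hence "continuous_on (ball 0 1) d" by (rule holomorphic_on_imp_continuous_on)
    hence "isCont d 0" by (simp add: continuous_on_eq_continuous_at)
    hence "(d \<longlongrightarrow> d 0) (at 0)" by (simp add: isCont_def)
    moreover have "\<forall>\<^sub>F x in at 0. d x = 0"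
      using eventually_disk[of "\<lambda>x. x * d x = 0", OF zd]
      by (auto simp: eventually_at_filter elim: eventually_mono)
    hence "(d \<longlongrightarrow> 0) (at 0)" by (rule tendsto_eventually)
    ultimately have "d 0 = 0" by (rule tendsto_unique[OF trivial_limit_at])
    thus ?thesis using zd[OF z] by (cases "z = 0") auto
  qed
  thus thesis using that[OF h(1) h(3)] by (simp add: d_def)
qed

text \<open>
  The equation is first order in \<open>f'\<close>, with solution \<open>f' = exp g\<close> for a primitive \<open>g\<close> of
  \<open>2 h / (1 - z h)\<close>; a second primitive gives \<open>f\<close>.
\<close>

lemma convex_of_schwarz_function:
  assumes h: "h holomorphic_on ball 0 1" and b: "\<And>z. cmod z < 1 \<Longrightarrow> cmod (h z) \<le> 1"
  obtains f where "f \<in> class_C"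
    "\<And>z. cmod z < 1 \<Longrightarrow> deriv (deriv f) z * (1 - z * h z) = 2 * h z * deriv f z"
proof -
  have lt: "cmod (z * h z) < 1" if "cmod z < 1" for z
    using mult_left_le[OF b[OF that] norm_ge_zero[of z]] that by (simp add: norm_mult)
  have nz: "1 - z * h z \<noteq> 0" if "cmod z < 1" for z
    using lt[OF that] by (metis eq_iff_diff_eq_0 norm_one order_less_irrefl)
  have "(\<lambda>z. 2 * h z / (1 - z * h z)) holomorphic_on ball 0 1"
    using nz by (intro holomorphic_intros h) auto
  from holomorphic_convex_primitive'[OF convex_ball open_ball this] obtain g0 where
    g0: "\<And>z. z \<in> ball 0 1 \<Longrightarrow>
      (g0 has_field_derivative 2 * h z / (1 - z * h z)) (at z within ball 0 1)" by metis
  define g where "g z = g0 z - g0 0" for z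
  have g: "(g has_field_derivative 2 * h z / (1 - z * h z)) (at z)" if "cmod z < 1" for z
    using g0[of z] that by (auto simp: g_def [abs_def] at_within_open[of z "ball 0 1"] intro!: derivative_eq_intros)
  have "(\<lambda>z. exp (g z)) holomorphic_on ball 0 1"
    using g by (intro holomorphic_intros) (force simp: holomorphic_on_open)
  from holomorphic_convex_primitive'[OF convex_ball open_ball this] obtain f0 where
    f0: "\<And>z. z \<in> ball 0 1 \<Longrightarrow>
      (f0 has_field_derivative exp (g z)) (at z within ball 0 1)" by metis
  define f where "f z = f0 z - f0 0" for z
  have f: "(f has_field_derivative exp (g z)) (at z)" if "cmod z < 1" for z
    using f0[of z] that by (auto simp: f_def [abs_def] at_within_open[of z "ball 0 1"] intro!: derivative_eq_intros)
  have df: "deriv f z = exp (g z)" if "cmod z < 1" for z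
    using f[OF that] by (rule DERIV_imp_deriv)
  have ddf: "deriv (deriv f) z = exp (g z) * (2 * h z / (1 - z * h z))" if z: "cmod z < 1" for z
  proof -
    have ev: "\<forall>\<^sub>F x in nhds z. deriv f x = exp (g x)"
      using eventually_nhds_in_open[of "ball (0::complex) 1" z] z df by (auto elim!: eventually_mono)
    have "((\<lambda>x. exp (g x)) has_field_derivative exp (g z) * (2 * h z / (1 - z * h z))) (at z)"
      by (rule DERIV_chain2[OF DERIV_exp g[OF z]])
    from DERIV_imp_deriv[OF this] show ?thesis using deriv_cong_ev[OF ev refl] by simp
  qed
  have pos: "Re (1 + z * deriv (deriv f) z / deriv f z) > 0" if z: "cmod z < 1" for z
  proof -
    define u where "u = z * h z"
    have u: "cmod u < 1" "1 - u \<noteq> 0" using lt[OF z] nz[OF z] by (auto simp: u_def)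
    have "1 + z * deriv (deriv f) z / deriv f z = (1 + u) / (1 - u)"
      using u(2) unfolding ddf[OF z] df[OF z] by (simp add: divide_simps u_def)
    moreover have "Re ((1 + u) / (1 - u)) = (1 - (cmod u)\<^sup>2) / (cmod (1 - u))\<^sup>2"
      unfolding cmod_power2 Re_divide by (simp add: power2_eq_square algebra_simps)
    moreover have "(cmod u)\<^sup>2 < 1" using u by (simp add: abs_square_less_1)
    ultimately show ?thesis using u by simp
  qed
  have "f holomorphic_on ball 0 1"
    unfolding holomorphic_on_open[OF open_ball] using f by (metis mem_ball_0)
  moreover have "deriv f 0 = 1" "f 0 = 0" using df[of 0] by (simp_all add: g_def f_def)
  ultimately have "f \<in> class_C"
    using df pos by (simp add: class_C_def class_A_def)
  moreover have "deriv (deriv f) z * (1 - z * h z) = 2 * h z * deriv f z" if "cmod z < 1" for z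
    using nz[OF that] by (simp add: df[OF that] ddf[OF that])
  ultimately show thesis by (rule that)
qed

lemma fps_convex_coeffs:
  fixes F H :: "complex fps"
  assumes F: "fps_nth F 1 = 1"
    and ode: "fps_deriv (fps_deriv F) * (1 - fps_X * H) = 2 * H * fps_deriv F"
  shows "fps_nth F 2 = fps_nth H 0"
    and "fps_nth F 3 = fps_nth H 1 / 3 + (fps_nth H 0)\<^sup>2"
    and "fps_nth F 4 = fps_nth H 2 / 6 + 5 / 6 * fps_nth H 0 * fps_nth H 1 + fps_nth H 0 ^ 3"
proof -
  have eq: "fps_deriv (fps_deriv F) = fps_X * (fps_deriv (fps_deriv F) * H) + fps_const 2 * (H * fps_deriv F)"
    using ode by (simp add: algebra_simps numeral_fps_const)
  have F': "fps_nth F (Suc 0) = 1" using F by simp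
  show F2: "fps_nth F 2 = fps_nth H 0"
    using arg_cong[OF eq, of "\<lambda>A. fps_nth A 0"] F' by (simp add: numeral_2_eq_2)
  have "6 * fps_nth F 3 = 2 * fps_nth F 2 * fps_nth H 0 + 2 * (2 * fps_nth H 0 * fps_nth F 2 + fps_nth H 1)"
    using arg_cong[OF eq, of "\<lambda>A. fps_nth A (Suc 0)"] F'
    by (simp add: fps_mult_nth numeral_2_eq_2 numeral_3_eq_3)
  thus F3: "fps_nth F 3 = fps_nth H 1 / 3 + (fps_nth H 0)\<^sup>2"
    unfolding F2 by (simp add: power2_eq_square) algebra
  have "12 * fps_nth F 4 = 2 * fps_nth F 2 * fps_nth H 1 + 6 * fps_nth F 3 * fps_nth H 0
     + 2 * (3 * fps_nth H 0 * fps_nth F 3 + 2 * fps_nth H 1 * fps_nth F 2 + fps_nth H 2)"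
    using arg_cong[OF eq, of "\<lambda>A. fps_nth A (Suc (Suc 0))"] F'
    by (simp add: fps_mult_nth numeral_2_eq_2 numeral_3_eq_3 eval_nat_numeral)
  thus "fps_nth F 4 = fps_nth H 2 / 6 + 5 / 6 * fps_nth H 0 * fps_nth H 1 + fps_nth H 0 ^ 3"
    unfolding F2 F3 by (simp add: power2_eq_square power3_eq_cube field_simps) algebra
qed

text \<open>
  If \<open>L\<close> is the logarithm of \<open>g w / w\<close> for the compositional inverse \<open>g\<close> of \<open>F\<close>, then substituting \<open>F\<close>
  turns \<open>w exp (L w) = g w\<close> into the assumption. Its derivative, freed from the exponential factor by
  multiplication with \<open>F\<close>, is \<open>X (P F' F + F') = F\<close> with \<open>P\<close> the composition of \<open>L'\<close> and \<open>F\<close>. This determines the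
  coefficients of \<open>L\<close> successively.
\<close>

lemma fps_log_coeffs:
  fixes F L :: "complex fps"
  assumes F: "fps_nth F 0 = 0" "fps_nth F 1 = 1" and L: "fps_nth L 0 = 0"
    and inv: "(fps_exp 1 oo (L oo F)) * F = fps_X"
  shows "fps_nth L 1 = - fps_nth F 2"
    and "fps_nth L 2 = 3 / 2 * (fps_nth F 2)\<^sup>2 - fps_nth F 3"
    and "fps_nth L 3 = 4 * fps_nth F 2 * fps_nth F 3 - fps_nth F 4 - 10 / 3 * fps_nth F 2 ^ 3"
proof -
  define P E where "P = fps_deriv L oo F" and "E = fps_exp 1 oo (L oo F)"
  have dE: "fps_deriv E = E * (P * fps_deriv F)"
    by (simp add: E_def P_def fps_compose_deriv F L)
  have "fps_deriv (E * F) = 1" using inv by (simp add: E_def)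
  hence "E * (P * fps_deriv F) * F + E * fps_deriv F = 1" by (simp add: dE algebra_simps)
  hence "(E * F) * (P * (fps_deriv F * F) + fps_deriv F) = F"
    by (metis (no_types, lifting) distrib_left mult.assoc mult.commute mult.left_commute mult_1)
  hence eq: "fps_X * (P * (fps_deriv F * F) + fps_deriv F) = F" using inv by (simp add: E_def)
  have F': "fps_nth F (Suc 0) = 1" using F by simp
  have P: "fps_nth P 0 = fps_nth L 1" "fps_nth P 1 = 2 * fps_nth L 2" 
     "fps_nth P 2 = 2 * fps_nth L 2 * fps_nth F 2 + 3 * fps_nth L 3"
    using F by (simp_all add: P_def fps_compose_nth numeral_2_eq_2 numeral_3_eq_3 fps_mult_nth)
  have 1: "fps_nth P 0 + 2 * fps_nth F 2 = fps_nth F 2"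
    using arg_cong[OF eq, of "\<lambda>A. fps_nth A 2"] F
    by (simp add: fps_mult_nth numeral_2_eq_2)
  have 2: "fps_nth P 0 * (3 * fps_nth F 2) + fps_nth P 1 + 3 * fps_nth F 3 = fps_nth F 3"
    using arg_cong[OF eq, of "\<lambda>A. fps_nth A 3"] F
    by (simp add: fps_mult_nth numeral_2_eq_2 numeral_3_eq_3)
  have 3: "fps_nth P 0 * (4 * fps_nth F 3 + 2 * (fps_nth F 2)\<^sup>2) + fps_nth P 1 * (3 * fps_nth F 2)
       + fps_nth P 2 + 4 * fps_nth F 4 = fps_nth F 4"
    using arg_cong[OF eq, of "\<lambda>A. fps_nth A 4"] F
    by (simp add: fps_mult_nth eval_nat_numeral algebra_simps)
  show L1: "fps_nth L 1 = - fps_nth F 2"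
    using 1 P by (simp add: eq_neg_iff_add_eq_0 add.commute)
  show L2: "fps_nth L 2 = 3 / 2 * (fps_nth F 2)\<^sup>2 - fps_nth F 3"
    using 2 unfolding P L1 by (simp add: power2_eq_square field_simps)
  show "fps_nth L 3 = 4 * fps_nth F 2 * fps_nth F 3 - fps_nth F 4 - 10 / 3 * fps_nth F 2 ^ 3"
    using 3 unfolding P L1 L2
    by (simp add: power2_eq_square power3_eq_cube field_simps) algebra
qed

lemma exp_log_inverse_quotient:
  assumes f: "f \<in> class_S" and z: "cmod z < 1"
  shows "exp (log_inverse_quotient f (f z)) * f z = z"
proof -
  have inj: "inj_on f (ball 0 1)" and f0: "f 0 = 0"
    using f by (auto simp: class_S_def class_A_def)
  have "disk_inverse f (f z) = z"
    unfolding disk_inverse_def using inj z by (intro inv_into_f_f) auto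
  moreover have "f z = 0 \<longleftrightarrow> z = 0"
    using inj_on_eq_iff[OF inj, of z 0] z f0 by simp
  ultimately show ?thesis by (cases "z = 0") (auto simp: log_inverse_quotient_def f0)
qed

lemma inv_log_coeff_taylor_coeffs:
  assumes f: "f \<in> class_S" and F: "f has_fps_expansion F"
  shows "inv_log_coeff f 1 = - fps_nth F 2 / 2"
    and "inv_log_coeff f 2 = (3 / 2 * (fps_nth F 2)\<^sup>2 - fps_nth F 3) / 2"
    and "inv_log_coeff f 3 =
      (4 * fps_nth F 2 * fps_nth F 3 - fps_nth F 4 - 10 / 3 * fps_nth F 2 ^ 3) / 2"
proof -
  define L where "L = Abs_fps (\<lambda>n. 2 * inv_log_coeff f n)"
  have L: "log_inverse_quotient f has_fps_expansion L"
    unfolding L_def by (rule log_inverse_quotient_has_fps_expansion[OF f])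
  have coeff: "inv_log_coeff f n = fps_nth L n / 2" for n by (simp add: L_def)
  have L0: "fps_nth L 0 = 0"
    using has_fps_expansion_imp_0_eq_fps_nth_0[OF L] by (simp add: log_inverse_quotient_def)
  have F0: "fps_nth F 0 = 0"
    using has_fps_expansion_imp_0_eq_fps_nth_0[OF F] f by (simp add: class_S_def class_A_def)
  have F1: "fps_nth F 1 = 1"
    using has_fps_expansion_imp_0_eq_fps_nth_0[OF has_fps_expansion_deriv[OF F]] f
    by (simp add: class_S_def class_A_def)
  have LF: "(log_inverse_quotient f \<circ> f) has_fps_expansion (L oo F)"
    by (rule has_fps_expansion_compose[OF L F F0])
  have "(exp \<circ> (log_inverse_quotient f \<circ> f)) has_fps_expansion (fps_exp 1 oo (L oo F))"
    using has_fps_expansion_compose[OF has_fps_expansion_exp[of 1] LF] L0 by simp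
  from has_fps_expansion_mult[OF this F]
  have inv: "(fps_exp 1 oo (L oo F)) * F = fps_X"
    by (rule fps_eq_of_eq_on_disk[OF _ has_fps_expansion_fps_X])
       (simp add: exp_log_inverse_quotient[OF f])
  show "inv_log_coeff f 1 = - fps_nth F 2 / 2"
    and "inv_log_coeff f 2 = (3 / 2 * (fps_nth F 2)\<^sup>2 - fps_nth F 3) / 2"
    and "inv_log_coeff f 3 =
      (4 * fps_nth F 2 * fps_nth F 3 - fps_nth F 4 - 10 / 3 * fps_nth F 2 ^ 3) / 2"
    unfolding coeff fps_log_coeffs[OF F0 F1 L0 inv] by (rule refl)+
qed

lemma inv_log_coeff_schwarz_coeffs:
  assumes S: "f \<in> class_S" and h: "h has_fps_expansion H"
    and ode: "\<And>z. cmod z < 1 \<Longrightarrow> deriv (deriv f) z * (1 - z * h z) = 2 * h z * deriv f z"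
  defines "c \<equiv> fps_nth H"
  shows "inv_log_coeff f 1 = - c 0 / 2"
    and "inv_log_coeff f 2 = - (2 * c 1 - 3 * (c 0)\<^sup>2) / 12"
    and "inv_log_coeff f 3 = - (c 2 - 3 * c 0 * c 1 + 2 * c 0 ^ 3) / 12"
proof -
  define F where "F = fps_expansion f 0"
  have F: "f has_fps_expansion F" 
    unfolding F_def using S by (intro holomorphic_disk_fps) (auto simp: class_S_def class_A_def)
  have F1: "fps_nth F 1 = 1"
    using has_fps_expansion_imp_0_eq_fps_nth_0[OF has_fps_expansion_deriv[OF F]] S
    by (simp add: class_S_def class_A_def)
  have d1: "deriv f has_fps_expansion fps_deriv F" by (rule has_fps_expansion_deriv[OF F])
  have d2: "deriv (deriv f) has_fps_expansion fps_deriv (fps_deriv F)"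
    by (rule has_fps_expansion_deriv[OF d1])
  have "fps_deriv (fps_deriv F) * (1 - fps_X * H) = fps_const 2 * H * fps_deriv F"
    by (rule fps_eq_of_eq_on_disk[OF has_fps_expansion_mult[OF d2 has_fps_expansion_diff[OF
            has_fps_expansion_1 has_fps_expansion_mult[OF has_fps_expansion_fps_X h]]]
          has_fps_expansion_mult[OF has_fps_expansion_mult[OF has_fps_expansion_const h] d1] ode])
  hence "fps_deriv (fps_deriv F) * (1 - fps_X * H) = 2 * H * fps_deriv F"
    by (simp add: numeral_fps_const)
  note co = fps_convex_coeffs[OF F1 this]
  show "inv_log_coeff f 1 = - c 0 / 2"
    and "inv_log_coeff f 2 = - (2 * c 1 - 3 * (c 0)\<^sup>2) / 12"
    and "inv_log_coeff f 3 = - (c 2 - 3 * c 0 * c 1 + 2 * c 0 ^ 3) / 12"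
    unfolding inv_log_coeff_taylor_coeffs[OF S F] co c_def
    by (simp_all add: field_simps power2_eq_square power3_eq_cube)
qed

section \<open>The extremal problems\<close>
lemma quadratic_coeff_bound_upper:
  fixes a b :: complex
  assumes b: "cmod b \<le> 1 - (cmod a)\<^sup>2"
  shows "cmod (2 * b - 3 * a\<^sup>2) - 6 * cmod a \<le> 2"
proof -
  define c where "c = cmod a"
  have c0: "0 \<le> c" by (simp add: c_def)
  have "c\<^sup>2 \<le> 1" using b norm_ge_zero[of b] unfolding c_def by linarith
  with c0 have c: "0 \<le> c" "c \<le> 1" by (simp_all add: abs_square_le_1)
  hence "c * c \<le> c * 1" by (intro mult_left_mono)
  moreover have "cmod (2 * b - 3 * a\<^sup>2) \<le> 2 * cmod b + 3 * c\<^sup>2"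
    using norm_triangle_ineq4[of "2 * b" "3 * a\<^sup>2"] by (simp add: norm_mult norm_power c_def)
  ultimately show ?thesis using b c by (simp add: power2_eq_square flip: c_def)
qed

text \<open>
  Here \<open>k = sqrt 10 / 5\<close>. For \<open>\<bar>a\<bar> \<le> k\<close> the subtracted modulus can vanish and is dropped; beyond \<open>k\<close>
  it is at least \<open>5 \<bar>a\<bar>\<^sup>2 - 2\<close>, which grows faster than \<open>6 \<bar>a\<bar>\<close>.
\<close>

lemma quadratic_coeff_bound_lower:
  fixes a b :: complex and k :: real
  assumes b: "cmod b \<le> 1 - (cmod a)\<^sup>2" and k: "0 < k" "5 * k\<^sup>2 = 2"
  shows "6 * cmod a - cmod (2 * b - 3 * a\<^sup>2) \<le> 6 * k"
proof (cases "cmod a \<le> k")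
  case True
  thus ?thesis using norm_ge_zero[of "2 * b - 3 * a\<^sup>2"] by linarith
next
  case False
  define c where "c = cmod a"
  have "3 * c\<^sup>2 - 2 * cmod b \<le> cmod (2 * b - 3 * a\<^sup>2)"
    using norm_triangle_ineq3[of "2 * b" "3 * a\<^sup>2"] by (simp add: norm_mult norm_power c_def)
  moreover have "3 / 5 \<le> k" by (rule power2_le_imp_le) (use k in \<open>auto simp: power2_eq_square\<close>)
  hence "0 \<le> (c - k) * (5 * (c + k) - 6)" using False by (intro mult_nonneg_nonneg) (auto simp: c_def)
  hence "0 \<le> 5 * c\<^sup>2 - 5 * k\<^sup>2 - 6 * c + 6 * k" by (simp add: algebra_simps power2_eq_square)
  ultimately show ?thesis using b k by (simp flip: c_def)
qed

text \<open>
  The two-variable maximum left once \<open>b\<close> is aligned with \<open>a\<^sup>2\<close>; again \<open>k = sqrt 10 / 5\<close>. In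
  \<open>r\<close> the expression increases up to \<open>r = 3/2 c\<^sup>2\<close> and, as long as \<open>c \<le> 2/3\<close>, decreases afterwards.
  For \<open>c \<ge> k\<close> the constraint \<open>r \<le> 1 - c\<^sup>2\<close> stops it before that point, and the resulting polynomial in
  \<open>c\<close> decreases from its value at \<open>k\<close>. For \<open>c < k\<close> the maximum over \<open>r\<close> is
  \<open>1 + c\<^sup>2 b(c) / (1 + c)\<close> with \<open>b(c) = c\<^sup>2 / 4 + 3/2 c - 1\<close>, where \<open>b(c) / (1 + c)\<close> increases.
  Both cases lead to the value \<open>8/5 k\<close> at \<open>c = k\<close>.
\<close>

lemma cubic_coeff_bound_real:
  fixes c r k :: real
  assumes k: "0 < k" "5 * k\<^sup>2 = 2" and c: "0 \<le> c" "c \<le> 1" and r: "0 \<le> r" "r \<le> 1 - c\<^sup>2"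
  shows "1 - c\<^sup>2 - r\<^sup>2 / (1 + c) + c * (3 * r - 2 * c\<^sup>2) - \<bar>2 * r - 3 * c\<^sup>2\<bar> \<le> 8 / 5 * k"
proof -
  define q where "q = c\<^sup>2"
  define G where "G x = 1 - q - x\<^sup>2 / (1 + c) + c * (3 * x - 2 * q)" for x
  \<comment> \<open>The lower bound on \<open>k\<close> makes \<open>8/5 k \<ge> 1\<close>; the upper one gives the monotonicity in \<open>r\<close> beyond \<open>3/2 c\<^sup>2\<close>.\<close>
  have k58: "5 / 8 \<le> k" by (rule power2_le_imp_le) (use k in \<open>auto simp: power2_eq_square\<close>)
  have k23: "k \<le> 2 / 3" by (rule power2_le_imp_le) (use k in \<open>auto simp: power2_eq_square\<close>)
  have G_diff: "G y - G x = (y - x) * (3 * c - (y + x) / (1 + c))" for x y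
    using c by (simp add: G_def divide_simps) algebra
  have "G r - \<bar>2 * r - 3 * q\<bar> \<le> 8 / 5 * k"
  proof (cases "k \<le> c")
    case True
    hence "k\<^sup>2 \<le> q" unfolding q_def using k by (intro power_mono) auto
    hence q: "2 \<le> 5 * q" using k by simp
    have r': "r \<le> 1 - q" using r(2) by (simp add: q_def)
    have "1 - q + r \<le> 2 * (1 + c)"
      using c(1) r' q by argo
    hence "(1 - q + r) / (1 + c) \<le> 2" using c by (simp add: divide_simps)
    hence "0 \<le> (1 - q - r) * (3 * c - (1 - q + r) / (1 + c) + 2)"
      using r c by (intro mult_nonneg_nonneg) (auto simp: q_def)
    hence "G r + 2 * r \<le> G (1 - q) + 2 * (1 - q)"
      using G_diff[of "1 - q" r] by (simp add: algebra_simps)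
    moreover have quot: "(1 - q)\<^sup>2 / (1 + c) = (1 - q) * (1 - c)"
      using c by (simp add: divide_simps q_def) algebra
    have "G (1 - q) = c * (4 - 6 * q)"
      unfolding G_def quot by (simp add: algebra_simps)
    hence "G (1 - q) + 2 * (1 - q) - 3 * q = 4 * c - 6 * c ^ 3 + 2 - 5 * c\<^sup>2"
      by (simp add: q_def algebra_simps power2_eq_square power3_eq_cube)
    moreover have "0 \<le> (c - k) * (6 * (c\<^sup>2 + c * k + k\<^sup>2) + 5 * (c + k) - 4)"
    proof (rule mult_nonneg_nonneg)
      have "0 \<le> c * k" using k c by simp
      moreover have "2 \<le> 5 * c\<^sup>2" using q by (simp add: q_def)
      ultimately show "0 \<le> 6 * (c\<^sup>2 + c * k + k\<^sup>2) + 5 * (c + k) - 4"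
        using k c(1) by argo
    qed (use True in simp)
    hence "4 * c - 6 * c ^ 3 + 2 - 5 * c\<^sup>2 \<le> 4 * k - 6 * k * k\<^sup>2 + 2 - 5 * k\<^sup>2"
      by (simp add: algebra_simps power2_eq_square power3_eq_cube)
    moreover have "6 * k * k\<^sup>2 = 12 / 5 * k" using k by simp
    ultimately show ?thesis using r q k by (simp add: q_def)
  next
    case False
    hence ck: "c < k" by simp
    have q0: "0 \<le> q" by (simp add: q_def)
    have "q \<le> k\<^sup>2" unfolding q_def using ck c by (intro power_mono) auto
    hence q: "5 * q \<le> 2" using k by simp
    have "G r - \<bar>2 * r - 3 * q\<bar> \<le> G (3 / 2 * q)"
    proof (cases "2 * r \<le> 3 * q")
      case True
      have "(3 / 2 * q + r) / (1 + c) \<le> 2"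
        using c True q by (simp add: divide_simps)
      hence "0 \<le> (3 / 2 * q - r) * (3 * c - (3 / 2 * q + r) / (1 + c) + 2)"
        using True c by (intro mult_nonneg_nonneg) auto
      thus ?thesis using True G_diff[of "3 / 2 * q" r] by (simp add: algebra_simps)
    next
      case False
      have "0 \<le> (r + 3 / 2 * q) / (1 + c)" using c r q0 by simp
      hence "(r - 3 / 2 * q) * (3 * c - (r + 3 / 2 * q) / (1 + c) - 2) \<le> 0"
        using False ck k23 by (intro mult_nonneg_nonpos) auto
      thus ?thesis using False G_diff[of r "3 / 2 * q"] by (simp add: algebra_simps)
    qed
    moreover define b where "b x = x\<^sup>2 / 4 + 3 / 2 * x - 1" for x :: real
    have "G (3 / 2 * q) * (1 + c) = (1 + c) + q * b c"
      using c by (simp add: G_def b_def q_def divide_simps) algebra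
    moreover have "q * b c \<le> (8 / 5 * k - 1) * (1 + c)"
    proof (cases "b c \<le> 0")
      case True
      have "q * b c \<le> 0" using True q0 by (simp add: mult_nonneg_nonpos)
      also have "0 \<le> (8 / 5 * k - 1) * (1 + c)" using k58 c by simp
      finally show ?thesis .
    next
      case False
      have "0 \<le> (k - c) * (5 / 2 + (k + c) / 4 + c * k / 4)"
        using ck c k by simp
      also have "\<dots> = b k * (1 + c) - b c * (1 + k)"
        by (simp add: b_def field_simps power2_eq_square)
      finally have le: "b c * (1 + k) \<le> b k * (1 + c)" by simp
      have "q * (b c * (1 + k)) \<le> k\<^sup>2 * (b k * (1 + c))"
        by (rule mult_mono[OF \<open>q \<le> k\<^sup>2\<close> le]) (use False k in auto)
      also have "\<dots> = (k\<^sup>2 * b k) * (1 + c)" by (simp only: mult.assoc)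
      also have "k\<^sup>2 * b k = (8 / 5 * k - 1) * (1 + k)"
      proof -
        have k2: "k\<^sup>2 = 2 / 5" using k by simp
        have "(8 / 5 * k - 1) * (1 + k) = 8 / 5 * k\<^sup>2 + 3 / 5 * k - 1"
          by (simp add: field_simps power2_eq_square)
        thus ?thesis by (simp add: b_def k2)
      qed
      finally have "(q * b c) * (1 + k) \<le> ((8 / 5 * k - 1) * (1 + c)) * (1 + k)"
        by (simp only: mult_ac)
      thus ?thesis using k by simp
    qed
    ultimately have "G (3 / 2 * q) * (1 + c) \<le> 8 / 5 * k * (1 + c)"
      by (simp add: algebra_simps)
    hence "G (3 / 2 * q) \<le> 8 / 5 * k" using c by simp
    thus ?thesis using \<open>G r - \<bar>2 * r - 3 * q\<bar> \<le> G (3 / 2 * q)\<close> by linarith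
  qed
  thus ?thesis by (simp add: G_def q_def)
qed

text \<open>
  Put \<open>c = \<bar>a\<bar>\<close>, \<open>q = c\<^sup>2\<close>, \<open>r = \<bar>b\<bar>\<close>, \<open>A = \<bar>3 b - 2 a\<^sup>2\<bar>\<close> and \<open>B = \<bar>2 b - 3 a\<^sup>2\<bar>\<close>. The difference \<open>A\<^sup>2 - B\<^sup>2 = 5 (r\<^sup>2 - q\<^sup>2)\<close> does not
  depend on the argument of \<open>b\<close>. If \<open>r \<le> q\<close>, then \<open>A \<le> B\<close>, and the left-hand side is at most 1. If
  \<open>r > q\<close>, then along this hyperbola \<open>c A - B\<close> is nonincreasing in \<open>B\<close>, so the least possible value
  \<open>B0 = \<bar>2 r - 3 q\<bar>\<close> of \<open>B\<close>, for which \<open>A = A0 = 3 r - 2 q\<close>, is the worst.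
\<close>

lemma cubic_coeff_bound:
  fixes a b d :: complex and k :: real
  assumes b: "cmod b \<le> 1 - (cmod a)\<^sup>2"
    and d: "cmod d \<le> 1 - (cmod a)\<^sup>2 - (cmod b)\<^sup>2 / (1 + cmod a)"
    and k: "0 < k" "5 * k\<^sup>2 = 2"
  shows "cmod (d - 3 * a * b + 2 * a ^ 3) - cmod (2 * b - 3 * a\<^sup>2) \<le> 8 / 5 * k"
proof -
  define c r q A B where "c = cmod a" and "r = cmod b" and "q = c\<^sup>2"
    and "A = cmod (3 * b - 2 * a\<^sup>2)" and "B = cmod (2 * b - 3 * a\<^sup>2)"
  have c2: "c\<^sup>2 \<le> 1" using b norm_ge_zero[of b] unfolding c_def by linarith
  have c: "0 \<le> c" "c \<le> 1" using c2 by (simp_all add: c_def abs_square_le_1)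
  have r: "0 \<le> r" "r \<le> 1 - q" using b by (simp_all add: r_def q_def c_def)
  have q: "q = cmod (a\<^sup>2)" "0 \<le> q" by (simp_all add: q_def c_def norm_power)
  have AB: "0 \<le> A" "0 \<le> B" by (simp_all add: A_def B_def)
  have diff: "A\<^sup>2 - B\<^sup>2 = 5 * (r\<^sup>2 - q\<^sup>2)"
    unfolding A_def B_def r_def q(1) cmod_power2 by (simp add: power2_eq_square algebra_simps)
  have "cmod (d - 3 * a * b + 2 * a ^ 3) \<le> cmod d + cmod (a * (3 * b - 2 * a\<^sup>2))"
    using norm_triangle_ineq4[of d "a * (3 * b - 2 * a\<^sup>2)"]
    by (simp add: algebra_simps power2_eq_square power3_eq_cube)
  also have "\<dots> \<le> 1 - q - r\<^sup>2 / (1 + c) + c * A"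
    using d by (simp add: norm_mult c_def r_def q_def A_def)
  finally have main: "cmod (d - 3 * a * b + 2 * a ^ 3) - B \<le> 1 - q - r\<^sup>2 / (1 + c) + (c * A - B)"
    by simp
  have "1 - q - r\<^sup>2 / (1 + c) + (c * A - B) \<le> 8 / 5 * k"
  proof (cases "r \<le> q")
    case True
    hence "r\<^sup>2 \<le> q\<^sup>2" using r by (intro power_mono) auto
    hence "A\<^sup>2 - B\<^sup>2 \<le> 0" unfolding diff by simp
    hence "A\<^sup>2 \<le> B\<^sup>2" by simp
    hence "A \<le> B" using AB(2) by (rule power2_le_imp_le)
    moreover have "c * A \<le> 1 * A" using c AB by (intro mult_right_mono)
    moreover have "0 \<le> r\<^sup>2 / (1 + c)" using c by simp
    moreover have "5 / 8 \<le> k" by (rule power2_le_imp_le) (use k in \<open>auto simp: power2_eq_square\<close>)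
    ultimately show ?thesis using q by linarith
  next
    case False
    define A0 B0 where "A0 = 3 * r - 2 * q" and "B0 = \<bar>2 * r - 3 * q\<bar>"
    have B0: "B0 \<le> B"
      using norm_triangle_ineq3[of "2 * b" "3 * a\<^sup>2"]
      by (simp add: B0_def B_def r_def q norm_mult)
    have A0: "0 < A0" "B0 \<le> A0" "0 \<le> B0" using False q(2) by (auto simp: A0_def B0_def)
    have "q\<^sup>2 \<le> r\<^sup>2" using False q by (intro power_mono) auto
    hence "0 \<le> A\<^sup>2 - B\<^sup>2" unfolding diff by simp
    hence "B\<^sup>2 \<le> A\<^sup>2" by simp
    hence BA: "B \<le> A" using AB(1) by (rule power2_le_imp_le)
    have "B0\<^sup>2 = (2 * r - 3 * q)\<^sup>2" by (simp add: B0_def)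
    hence "(A - A0) * (A + A0) = (B - B0) * (B + B0)"
      using diff by (simp add: A0_def algebra_simps power2_eq_square)
    also have "\<dots> \<le> (B - B0) * (A + A0)"
      using B0 BA A0 by (intro mult_left_mono) auto
    finally have "A - A0 \<le> B - B0" using A0 AB by simp
    hence "c * (A - A0) \<le> c * (B - B0)" using c by (intro mult_left_mono)
    also have "\<dots> \<le> 1 * (B - B0)" using c B0 by (intro mult_right_mono) auto
    finally have "c * A - B \<le> c * A0 - B0" by (simp add: algebra_simps)
    thus ?thesis
      using cubic_coeff_bound_real[OF k c r(1) r(2)[unfolded q_def]] by (simp add: A0_def B0_def q_def)
  qed
  with main show ?thesis unfolding B_def by linarith
qed

text \<open>
  These functions come from \<open>h z = (c + z) / (1 + c z)\<close>, whose coefficients are \<open>c\<close>, \<open>1 - c\<^sup>2\<close>,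
  \<open>- c (1 - c\<^sup>2)\<close>.
\<close>

lemma class_C_moebius_function:
  fixes c :: real
  assumes c: "0 \<le> c" "c < 1"
  obtains f where "f \<in> class_C"
    "inv_log_coeff f 1 = - of_real (c / 2)"
    "inv_log_coeff f 2 = - of_real ((2 - 5 * c\<^sup>2) / 12)"
    "inv_log_coeff f 3 = of_real ((2 * c - 3 * c ^ 3) / 6)"
proof -
  define h where "h z = (of_real c + z) / (1 + of_real c * z)" for z :: complex
  have nz: "1 + of_real c * z \<noteq> 0" if "cmod z < 1" for z
  proof
    assume "1 + of_real c * z = 0"
    hence "cmod (of_real c * z) = 1" by (metis add_eq_0_iff norm_minus_cancel norm_one)
    moreover have "c * cmod z \<le> c * 1" using c that by (intro mult_left_mono) auto
    ultimately show False using c by (simp add: norm_mult)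
  qed
  have hol: "h holomorphic_on ball 0 1"
    unfolding h_def using nz by (intro holomorphic_intros) auto
  have b: "cmod (h z) \<le> 1" if "cmod z < 1" for z
    using Moebius_function_norm_lt_1[of "- of_real c" z 0] c that
    by (simp add: h_def Moebius_function_def add.commute)
  define H where "H = fps_expansion h 0"
  have H: "h has_fps_expansion H" unfolding H_def by (rule holomorphic_disk_fps[OF hol])
  have "H * (1 + fps_const (of_real c) * fps_X) = fps_const (of_real c) + fps_X"
  proof (rule fps_eq_of_eq_on_disk)
    show "(\<lambda>z. h z * (1 + of_real c * z)) has_fps_expansion H * (1 + fps_const (of_real c) * fps_X)"
      by (intro fps_expansion_intros H)
    show "(\<lambda>z. of_real c + z) has_fps_expansion fps_const (of_real c) + fps_X"
      by (intro fps_expansion_intros)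
  qed (simp add: h_def nz)
  hence eq: "H + fps_const (of_real c) * (fps_X * H) = fps_const (of_real c) + fps_X"
    by (simp add: algebra_simps)
  have H0: "fps_nth H 0 = of_real c"
    using arg_cong[OF eq, of "\<lambda>F. fps_nth F 0"] by simp
  have H1: "fps_nth H 1 = of_real (1 - c\<^sup>2)"
    using arg_cong[OF eq, of "\<lambda>F. fps_nth F 1"] H0 by (simp add: eq_diff_eq power2_eq_square)
  have H2: "fps_nth H 2 = - of_real (c * (1 - c\<^sup>2))"
    using arg_cong[OF eq, of "\<lambda>F. fps_nth F 2"] H1 by (simp add: eq_neg_iff_add_eq_0)
  obtain f where f: "f \<in> class_C"
    "\<And>z. cmod z < 1 \<Longrightarrow> deriv (deriv f) z * (1 - z * h z) = 2 * h z * deriv f z"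
    using convex_of_schwarz_function[OF hol b] by blast
  have "f \<in> class_S" using f class_C_subset_class_S by blast
  note co = inv_log_coeff_schwarz_coeffs[OF this H f(2), unfolded H0 H1 H2]
  show thesis
  proof (rule that[OF f(1)])
    show "inv_log_coeff f 1 = - of_real (c / 2)" using co(1) by simp
    show "inv_log_coeff f 2 = - of_real ((2 - 5 * c\<^sup>2) / 12)" by (simp add: co(2) field_simps)
    show "inv_log_coeff f 3 = of_real ((2 * c - 3 * c ^ 3) / 6)"
      using co(3) by (simp add: field_simps power2_eq_square power3_eq_cube) algebra
  qed
qed

theorem theorem5:
  shows "(\<forall>f\<in>class_C.
            - sqrt 10 / 10 \<le> cmod (inv_log_coeff f 2) - cmod (inv_log_coeff f 1) \<and>
            cmod (inv_log_coeff f 2) - cmod (inv_log_coeff f 1) \<le> 1 / 6 \<and>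
            cmod (inv_log_coeff f 3) - cmod (inv_log_coeff f 2) \<le> 2 * sqrt 10 / 75) \<and>
         (\<exists>f\<in>class_C. cmod (inv_log_coeff f 2) - cmod (inv_log_coeff f 1) = - sqrt 10 / 10) \<and>
         (\<exists>f\<in>class_C. cmod (inv_log_coeff f 2) - cmod (inv_log_coeff f 1) = 1 / 6) \<and>
         (\<exists>f\<in>class_C. cmod (inv_log_coeff f 3) - cmod (inv_log_coeff f 2) = 2 * sqrt 10 / 75)"
proof -
  define k where "k = sqrt 10 / 5"
  \<comment> \<open>The value \<open>k = sqrt (2/5)\<close> of \<open>\<bar>a\<bar>\<close> is the one at which \<open>\<Gamma>\<^sub>2 = 0\<close> and \<open>\<bar>b\<bar> = 1 - \<bar>a\<bar>\<^sup>2\<close> hold together.\<close>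
  have k: "0 < k" "5 * k\<^sup>2 = 2" by (simp_all add: k_def power_divide)
  have "k < 1" by (rule power2_less_imp_less) (use k in auto)
  have bounds: "- sqrt 10 / 10 \<le> cmod (inv_log_coeff f 2) - cmod (inv_log_coeff f 1) \<and>
        cmod (inv_log_coeff f 2) - cmod (inv_log_coeff f 1) \<le> 1 / 6 \<and>
        cmod (inv_log_coeff f 3) - cmod (inv_log_coeff f 2) \<le> 2 * sqrt 10 / 75"
    if f: "f \<in> class_C" for f
  proof -
    obtain h where h: "h holomorphic_on ball 0 1" "\<And>z. cmod z < 1 \<Longrightarrow> cmod (h z) \<le> 1"
      "\<And>z. cmod z < 1 \<Longrightarrow> deriv (deriv f) z * (1 - z * h z) = 2 * h z * deriv f z"
      using convex_schwarz_function[OF f] by blast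
    define H where "H = fps_expansion h 0"
    have H: "h has_fps_expansion H" unfolding H_def by (rule holomorphic_disk_fps[OF h(1)])
    have S: "f \<in> class_S" using f class_C_subset_class_S by blast
    have co: "inv_log_coeff f 1 = - fps_nth H 0 / 2"
        "inv_log_coeff f 2 = - (2 * fps_nth H 1 - 3 * (fps_nth H 0)\<^sup>2) / 12"
        "inv_log_coeff f 3 = - (fps_nth H 2 - 3 * fps_nth H 0 * fps_nth H 1 + 2 * fps_nth H 0 ^ 3) / 12"
      by (simp_all only: inv_log_coeff_schwarz_coeffs[OF S H h(3)])
    have G1: "cmod (inv_log_coeff f 1) = cmod (fps_nth H 0) / 2"
      unfolding co by (simp add: norm_divide)
    have G2: "cmod (inv_log_coeff f 2) = cmod (2 * fps_nth H 1 - 3 * (fps_nth H 0)\<^sup>2) / 12"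
      unfolding co norm_divide norm_minus_cancel by simp
    have G3: "cmod (inv_log_coeff f 3) =
        cmod (fps_nth H 2 - 3 * fps_nth H 0 * fps_nth H 1 + 2 * fps_nth H 0 ^ 3) / 12"
      unfolding co norm_divide norm_minus_cancel by simp
    have s1: "cmod (fps_nth H 1) \<le> 1 - (cmod (fps_nth H 0))\<^sup>2"
      by (rule schwarz_coeff_1_bound[OF h(1,2) H])
    have s2: "cmod (fps_nth H 2) \<le>
        1 - (cmod (fps_nth H 0))\<^sup>2 - (cmod (fps_nth H 1))\<^sup>2 / (1 + cmod (fps_nth H 0))"
      by (rule schwarz_coeff_2_bound[OF h(1,2) H])
    show ?thesis
      using quadratic_coeff_bound_lower[OF s1 k] quadratic_coeff_bound_upper[OF s1] cubic_coeff_bound[OF s1 s2 k]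
      unfolding G1 G2 G3 k_def by (simp add: field_simps)
  qed
  obtain f where f: "f \<in> class_C" "inv_log_coeff f 1 = - of_real (k / 2)"
    "inv_log_coeff f 2 = - of_real ((2 - 5 * k\<^sup>2) / 12)"
    "inv_log_coeff f 3 = of_real ((2 * k - 3 * k ^ 3) / 6)"
    using class_C_moebius_function[of k] k \<open>k < 1\<close> by auto
  have k3: "(2 * k - 3 * k ^ 3) / 6 = 2 * sqrt 10 / 75"
  proof -
    have "k ^ 3 = k * k\<^sup>2" by (simp add: power2_eq_square power3_eq_cube)
    also have "\<dots> = 2 / 5 * k" using k by simp
    finally show ?thesis by (simp add: k_def)
  qed
  have "cmod (inv_log_coeff f 2) = 0" unfolding f(3) k by simp
  moreover have "cmod (inv_log_coeff f 1) = sqrt 10 / 10"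
    unfolding f(2) norm_minus_cancel norm_of_real by (simp add: k_def)
  moreover have "cmod (inv_log_coeff f 3) = 2 * sqrt 10 / 75"
    unfolding f(4) k3 norm_of_real by simp
  \<comment> \<open>For \<open>c = 0\<close> the function \<open>h\<close> is the identity and \<open>\<Gamma>\<^sub>1\<close> vanishes.\<close>
  moreover obtain g where "g \<in> class_C" "inv_log_coeff g 1 = - of_real (0 / 2)"
    "inv_log_coeff g 2 = - of_real ((2 - 5 * 0\<^sup>2) / 12)"
    using class_C_moebius_function[of 0] by auto
  hence "cmod (inv_log_coeff g 2) - cmod (inv_log_coeff g 1) = 1 / 6"
    by simp
  ultimately show ?thesis
    using bounds f(1) \<open>g \<in> class_C\<close> by force
qed

end
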